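(* Let $K$ be a set in $\mathbb{E}^d$ and let $\mathcal{F}$ be a family of spindle starshaped sets in $\mathbb{E}^d$ such that the intersection of any countable subfamily of $\mathcal{F}$ is a spindle starshaped set whose spindle kernel contains a translate of $K$. Then $\ker_{\mathrm{s}}\big(\bigcap\mathcal{F}\big)$ also contains a translate of $K$.
   Context: For $x,y\in\mathbb{E}^d$ the spindle $[x,y]_{\mathrm{s}}$ is the intersection of all closed unit balls containing $x$ and $y$ if $|x-y|\le2$, and $\mathbb{E}^d$ otherwise. For $A\subseteq\mathbb{E}^d$, $p\in A$: $\operatorname{st}_{\mathrm{s}}(p,A)=\{q\in A:[p,q]_{\mathrm{s}}\subseteq A\}$; $\ker_{\mathrm{s}}A=\{p\in A:\operatorname{st}_{\mathrm{s}}(p,A)=A\}$; $A$ is spindle starshaped if $\ker_{\mathrm{s}}A\ne\emptyset$. *)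

theory Defs
  imports "HOL-Analysis.Analysis"
begin

definition spindle :: "'a::euclidean_space \<Rightarrow> 'a \<Rightarrow> 'a set" where
  "spindle x y = (if dist x y \<le> 2
      then \<Inter> {cball c 1 | c. x \<in> cball c 1 \<and> y \<in> cball c 1}
      else UNIV)"

definition spindle_star :: "'a::euclidean_space \<Rightarrow> 'a set \<Rightarrow> 'a set" where
  "spindle_star p A = {q \<in> A. spindle p q \<subseteq> A}"

definition spindle_kernel :: "'a::euclidean_space set \<Rightarrow> 'a set" where
  "spindle_kernel A = {p \<in> A. spindle_star p A = A}"

definition spindle_starshaped :: "'a::euclidean_space set \<Rightarrow> bool" where
  "spindle_starshaped A \<longleftrightarrow> spindle_kernel A \<noteq> {}"

end

theory Submission
  imports Defs
begin

text \<open>By the Lindeloef property there is a countable subfamily G0 of F such that all countable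
  subfamilies containing it have intersections B with the same closure X. A spindle with distinct
  endpoints has interior points, which are stable under moving the endpoints; hence each such B
  satisfies int X \<open>\<subseteq>\<close> B \<open>\<subseteq>\<close> X and ker B \<open>\<subseteq>\<close> ker X, and the intersection of F lies between int X
  and X, too. A spindle triangle is the join of a vertex with the opposite spindle, so ker X is
  spindle convex. If two distinct translates of K lie in ker X, the translate halfway between
  them lies in int (ker X), and spindles from a point of int (ker X) to a point q of X lie in
  int X except for q. Otherwise ker X contains just one translate of K, which therefore is the one
  in the kernel of every B.\<close>

section \<open>Spindles and strict spindles\<close>

text \<open>An explicit open substitute for the interior of a spindle. If the endpoints are more
  than 2 apart there are no centres \<open>e\<close>, and it is the whole space.\<close>

definition strict_spindle :: "'a::euclidean_space \<Rightarrow> 'a \<Rightarrow> 'a set" where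
  "strict_spindle p q = {z. \<forall>e. dist e p \<le> 1 \<longrightarrow> dist e q \<le> 1 \<longrightarrow> dist e z < 1}"

text \<open>By the triangle inequality, points more than 2 apart lie in no common closed unit ball.
  The condition on centres is then vacuous and absorbs the case distinction of the
  definition.\<close>

lemma spindle_eq: "spindle p q = {z. \<forall>e. dist e p \<le> 1 \<longrightarrow> dist e q \<le> 1 \<longrightarrow> dist e z \<le> 1}"
proof (cases "dist p q \<le> 2")
  case True
  then show ?thesis unfolding spindle_def by auto
next
  case False
  have "\<not> (dist e p \<le> 1 \<and> dist e q \<le> 1)" for e
    using False dist_triangle3[of p q e] by auto
  with False show ?thesis unfolding spindle_def by auto
qed

lemma spindle_commute: "spindle p q = spindle q p"
  by (auto simp: spindle_eq)

lemma right_in_spindle: "q \<in> spindle p q"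
  by (auto simp: spindle_eq)

lemma strict_spindle_subset: "strict_spindle p q \<subseteq> spindle p q"
  by (force simp: strict_spindle_def spindle_eq intro: less_imp_le)

lemma spindle_self: "spindle p p = {p :: 'a::euclidean_space}"
proof -
  have "z = p" if z: "z \<in> spindle p p" for z
  proof (rule ccontr)
    assume "z \<noteq> p"
    \<comment> \<open>The centre at distance 1 from \<open>p\<close> on the side opposite to
      \<open>z\<close>, so that \<open>z\<close> is at distance
      \<open>1 + norm (z - p)\<close>.\<close>
    define e where "e = p - (1 / norm (z - p)) *\<^sub>R (z - p)"
    have "dist e p \<le> 1"
      using \<open>z \<noteq> p\<close> by (simp add: e_def dist_norm)
    moreover have "z - e = (1 + 1 / norm (z - p)) *\<^sub>R (z - p)"
      by (simp add: e_def algebra_simps)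
    then have "dist e z = (1 + 1 / norm (z - p)) * norm (z - p)"
      unfolding dist_norm norm_minus_commute[of e z] by (simp add: add_nonneg_nonneg)
    then have "dist e z = norm (z - p) + 1"
      using \<open>z \<noteq> p\<close> by (simp add: distrib_right)
    ultimately show False
      using z \<open>z \<noteq> p\<close> by (force simp: spindle_eq)
  qed
  then show ?thesis using right_in_spindle[of p p] by blast
qed

lemma spindle_kernel_iff:
  "p \<in> spindle_kernel A \<longleftrightarrow> p \<in> A \<and> (\<forall>q\<in>A. spindle p q \<subseteq> A)"
  by (auto simp: spindle_kernel_def spindle_star_def)

text \<open>Balls are strictly convex.\<close>

lemma open_segment_strict_spindle: "z \<in> open_segment p q \<Longrightarrow> z \<in> strict_spindle p q"
  unfolding strict_spindle_def using dist_decreases_open_segment[of z p q]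
  by (auto intro: less_le_trans)

lemma spindle_segment_strict_spindle:
  assumes "z \<in> spindle p q" "m \<in> strict_spindle p q" "x \<in> open_segment z m"
  shows "x \<in> strict_spindle p q"
  using assms dist_decreases_open_segment[of x z m]
  unfolding strict_spindle_def spindle_eq mem_Collect_eq by (meson less_le_trans less_trans)

text \<open>The relevant centres lie in the compact ball \<open>cball p 1\<close>, and projecting a
  closed set along a compact factor gives a closed set, here the complement. Openness is joint, so
  that either the endpoint \<open>q\<close> or the point \<open>z\<close> can be perturbed.\<close>

lemma open_strict_spindle: "open {(q, z). z \<in> strict_spindle p q}"
proof -
  have "closed {y. \<exists>e. e \<in> cball p 1 \<and> (e, y) \<in> {(e, q, z). dist e q \<le> 1 \<and> 1 \<le> dist e z}}"
  proof (rule closed_compact_projection)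
    show "closed {(e, q, z). dist e q \<le> 1 \<and> 1 \<le> dist e z}"
      unfolding case_prod_beta
      by (intro closed_Collect_conj closed_Collect_le continuous_intros)
  qed auto
  also have "{y. \<exists>e. e \<in> cball p 1 \<and> (e, y) \<in> {(e, q, z). dist e q \<le> 1 \<and> 1 \<le> dist e z}}
      = - {(q, z). z \<in> strict_spindle p q}"
    by (auto simp: strict_spindle_def dist_commute[of p] not_less)
  finally show ?thesis by (simp add: closed_def)
qed

lemma open_strict_spindle_endpoint: "open {q. z \<in> strict_spindle p q}"
proof -
  have "open ((\<lambda>q. (q, z)) -` {(q, z). z \<in> strict_spindle p q})"
    by (intro open_vimage open_strict_spindle continuous_intros)
  then show ?thesis by (simp add: vimage_def)
qed

lemma open_strict_spindle_section: "open (strict_spindle p q)"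
proof -
  have "open ((\<lambda>z. (q, z)) -` {(q, z). z \<in> strict_spindle p q})"
    by (intro open_vimage open_strict_spindle continuous_intros)
  then show ?thesis by (simp add: vimage_def)
qed

lemma extend_segment_in_open:
  fixes m q :: "'a::real_normed_vector"
  assumes "open U" "m \<in> U" "m \<noteq> q"
  obtains p where "p \<in> U" "m \<in> open_segment p q"
proof -
  have "((\<lambda>s. m + s *\<^sub>R (m - q)) \<longlongrightarrow> m + 0 *\<^sub>R (m - q)) (at_right 0)"
    by (intro tendsto_intros)
  then have "\<forall>\<^sub>F s in at_right 0. m + s *\<^sub>R (m - q) \<in> U"
    using assms by (intro topological_tendstoD[of _ m]) auto
  moreover have "\<forall>\<^sub>F s in at_right (0::real). s > 0"
    by (simp add: eventually_at_right_less)
  ultimately have "\<forall>\<^sub>F s in at_right (0::real). s > 0 \<and> m + s *\<^sub>R (m - q) \<in> U"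
    by eventually_elim auto
  then obtain s where s: "s > 0" "m + s *\<^sub>R (m - q) \<in> U"
    using eventually_happens trivial_limit_at_right_real by blast
  define p where "p = m + s *\<^sub>R (m - q)"
  have pq: "p - q = (1 + s) *\<^sub>R (m - q)"
    by (simp add: p_def algebra_simps)
  then have "m = q + (1 / (1 + s)) *\<^sub>R (p - q)"
    using s(1) by simp
  then have "m = (1 - 1 / (1 + s)) *\<^sub>R q + (1 / (1 + s)) *\<^sub>R p"
    by (simp add: algebra_simps)
  moreover have "q \<noteq> p"
    using assms(3) s(1) pq by force
  moreover have "0 < 1 / (1 + s)" "1 / (1 + s) < 1"
    using s(1) by auto
  ultimately have "m \<in> open_segment q p"
    unfolding in_segment by blast
  with s(2) show ?thesis using that by (simp add: p_def open_segment_commute)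
qed

section \<open>Spindle kernels and closures\<close>

text \<open>Prolong the segment from \<open>p\<close> to \<open>z\<close> slightly, to a point
  \<open>q\<close> of the closure. Then \<open>z\<close> is in the strict spindle of
  \<open>p\<close> and \<open>q\<close>, and stays there when \<open>q\<close> is replaced by a
  nearby point of \<open>B\<close>.\<close>

lemma interior_closure_subset_of_kernel:
  assumes p: "p \<in> spindle_kernel B"
  shows "interior (closure B) \<subseteq> B"
proof
  fix z assume z: "z \<in> interior (closure B)"
  show "z \<in> B"
  proof (cases "z = p")
    case True
    with p show ?thesis by (simp add: spindle_kernel_iff)
  next
    case False
    then obtain q where "q \<in> interior (closure B)" "z \<in> open_segment q p"
      using extend_segment_in_open[of "interior (closure B)" z p] z by auto
    then have q: "q \<in> closure B" "z \<in> open_segment p q"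
      using interior_subset by (auto simp: open_segment_commute)
    then have "q \<in> {q. z \<in> strict_spindle p q}"
      by (simp add: open_segment_strict_spindle)
    moreover note q(1)
    ultimately have "{q. z \<in> strict_spindle p q} \<inter> B \<noteq> {}"
      using open_Int_closure_eq_empty[OF open_strict_spindle_endpoint, of z p B] by blast
    then obtain q' where "q' \<in> B" "z \<in> strict_spindle p q'"
      by blast
    then show ?thesis
      using p strict_spindle_subset by (fastforce simp: spindle_kernel_iff)
  qed
qed

text \<open>Perturbing the endpoint \<open>q\<close> puts the strict spindle of \<open>p\<close> and
  \<open>q\<close> into \<open>B\<close> itself. Any other point of the spindle is a limit of strict
  ones along the segment to the midpoint \<open>m\<close>.\<close>

lemma spindle_kernel_closure:
  assumes p: "p \<in> spindle_kernel B"
  shows "p \<in> spindle_kernel (closure B)"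
proof -
  have pB: "p \<in> B" "\<And>q. q \<in> B \<Longrightarrow> spindle p q \<subseteq> B"
    using p by (auto simp: spindle_kernel_iff)
  have "z \<in> closure B" if q: "q \<in> closure B" and z: "z \<in> spindle p q" for q z
  proof (cases "p = q")
    case True
    then show ?thesis using pB z closure_subset by blast
  next
    case False
    define m where "m = midpoint p q"
    have m: "m \<in> strict_spindle p q"
      using False by (simp add: m_def open_segment_strict_spindle)
    have strict: "x \<in> B" if "x \<in> strict_spindle p q" for x
    proof -
      have "{q. x \<in> strict_spindle p q} \<inter> B \<noteq> {}"
        using open_Int_closure_eq_empty[OF open_strict_spindle_endpoint, of x p B] q that by blast
      then show ?thesis using pB strict_spindle_subset by blast
    qed
    show ?thesis
    proof (cases "z = m")
      case True
      then show ?thesis using m strict closure_subset by blast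
    next
      case False
      then have "z \<in> closure (open_segment z m)"
        by (simp add: closure_open_segment)
      moreover have "open_segment z m \<subseteq> B"
        using spindle_segment_strict_spindle[OF z m] strict by blast
      ultimately show ?thesis using closure_mono by blast
    qed
  qed
  then show ?thesis
    using pB(1) closure_subset[of B] by (auto simp: spindle_kernel_iff)
qed

section \<open>First-order variation of ball centres\<close>

text \<open>The squared distance has derivative \<open>- 2 * (v \<bullet> (x - e))\<close> at
  \<open>s = 0\<close>.\<close>

lemma eventually_dist_decreasing:
  fixes e v x :: "'a::real_inner"
  assumes "v \<bullet> (x - e) > 0"
  shows "\<forall>\<^sub>F s in at_right 0. dist (e + s *\<^sub>R v) x < dist e x"
proof -
  have "((\<lambda>s. 2 * (v \<bullet> (x - e)) - s * (v \<bullet> v)) \<longlongrightarrow> 2 * (v \<bullet> (x - e)) - 0 * (v \<bullet> v)) (at_right 0)"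
    by (intro tendsto_intros)
  then have "\<forall>\<^sub>F s in at_right 0. 2 * (v \<bullet> (x - e)) - s * (v \<bullet> v) > 0"
    by (rule order_tendstoD) (use assms in simp)
  moreover have "\<forall>\<^sub>F s in at_right (0::real). s > 0"
    by (simp add: eventually_at_right_less)
  ultimately show ?thesis
  proof eventually_elim
    case (elim s)
    have "(dist (e + s *\<^sub>R v) x)\<^sup>2 = (dist e x)\<^sup>2 - s * (2 * (v \<bullet> (x - e)) - s * (v \<bullet> v))"
      unfolding dist_norm power2_norm_eq_inner
      by (simp add: inner_simps algebra_simps inner_commute)
    also have "\<dots> < (dist e x)\<^sup>2"
      using elim by simp
    finally show ?case
      by (rule power2_less_imp_less) simp
  qed
qed

lemma dist_increasing:
  fixes e v x :: "'a::real_inner"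
  assumes "v \<bullet> (x - e) < 0" "s > 0"
  shows "dist e x < dist (e + s *\<^sub>R v) x"
proof -
  have "(dist (e + s *\<^sub>R v) x)\<^sup>2 = (dist e x)\<^sup>2 + (s * s * (v \<bullet> v) - 2 * s * (v \<bullet> (x - e)))"
    unfolding dist_norm power2_norm_eq_inner
    by (simp add: inner_simps algebra_simps inner_commute)
  moreover have "s * (v \<bullet> (x - e)) < 0"
    using assms by (simp add: mult_pos_neg)
  moreover have "0 \<le> s * s * (v \<bullet> v)"
    by simp
  ultimately have "(dist e x)\<^sup>2 < (dist (e + s *\<^sub>R v) x)\<^sup>2"
    by linarith
  then show ?thesis
    by (rule power2_less_imp_less) simp
qed

text \<open>A condition on the direction \<open>v\<close> is required only where the constraint is
  tight; slack constraints survive by continuity.\<close>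

lemma eventually_dist_le:
  fixes e v x :: "'a::real_inner"
  assumes "dist e x \<le> r" "dist e x = r \<Longrightarrow> v \<bullet> (x - e) > 0"
  shows "\<forall>\<^sub>F s in at_right 0. dist (e + s *\<^sub>R v) x \<le> r"
proof (cases "dist e x = r")
  case True
  then show ?thesis
    using eventually_dist_decreasing[of v x e] assms(2) by (auto elim: eventually_mono)
next
  case False
  have "((\<lambda>s. dist (e + s *\<^sub>R v) x) \<longlongrightarrow> dist (e + 0 *\<^sub>R v) x) (at_right 0)"
    by (intro tendsto_intros)
  then have "\<forall>\<^sub>F s in at_right 0. dist (e + s *\<^sub>R v) x < r"
    by (rule order_tendstoD) (use False assms(1) in simp)
  then show ?thesis by (rule eventually_mono) simp
qed

text \<open>An alternative of Farkas type: if the ray through \<open>g\<close> misses the hull, a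
  separating hyperplane, tilted a little, gives a forbidden direction \<open>v\<close>.\<close>

lemma convex_hull_ray_alternative:
  fixes S :: "'a::euclidean_space set"
  assumes "finite S" "\<And>v. (\<And>x. x \<in> S \<Longrightarrow> v \<bullet> x > 0) \<Longrightarrow> v \<bullet> g < 0 \<Longrightarrow> False" "g \<noteq> 0"
  obtains r where "r \<ge> 0" "r *\<^sub>R g \<in> convex hull S"
proof (cases "S = {}")
  case True
  then show ?thesis using assms(2)[of "- g"] assms(3) by simp
next
  case False
  define R where "R = (\<lambda>r. r *\<^sub>R g) ` {0..}"
  show ?thesis
  proof (cases "R \<inter> convex hull S = {}")
    case disj: True
    have "convex R"
      unfolding R_def by (intro convex_linear_image) (auto simp: linear_iff algebra_simps)
    moreover have "closed R"
      unfolding R_def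
      by (intro closed_injective_linear_image) (use assms(3) in \<open>auto simp: linear_iff algebra_simps inj_def\<close>)
    moreover have "compact (convex hull S)"
      using assms(1) by (simp add: finite_imp_compact_convex_hull)
    ultimately obtain v b where vb: "\<forall>x\<in>R. v \<bullet> x < b" "\<forall>x\<in>convex hull S. v \<bullet> x > b"
      using separating_hyperplane_closed_compact[of R "convex hull S"] disj False by auto
    have b: "b > 0"
      using vb(1) by (force simp: R_def)
    have "v \<bullet> g \<le> 0"
    proof (rule ccontr)
      assume "\<not> v \<bullet> g \<le> 0"
      then have "(b / (v \<bullet> g)) *\<^sub>R g \<in> R"
        using b by (auto simp: R_def)
      then show False using vb(1) \<open>\<not> v \<bullet> g \<le> 0\<close> by fastforce
    qed
    obtain M where M: "M > 0" "\<And>x. x \<in> S \<Longrightarrow> norm x \<le> M"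
      using assms(1) finite_imp_bounded bounded_pos by metis
    \<comment> \<open>Chosen so that \<open>t * (g \<bullet> x) \<le> b\<close> on \<open>S\<close>.
      As \<open>v \<bullet> x > b\<close> there, the tilted vector \<open>v - t *\<^sub>R g\<close>
      remains positive on \<open>S\<close> and becomes strictly negative on
      \<open>g\<close>.\<close>
    define t where "t = b / (M * norm g)"
    have "t > 0" using b M(1) assms(3) by (simp add: t_def)
    have "(v - t *\<^sub>R g) \<bullet> x > 0" if "x \<in> S" for x
    proof -
      have "g \<bullet> x \<le> norm g * norm x" by (rule norm_cauchy_schwarz)
      also have "\<dots> \<le> M * norm g"
        using mult_left_mono[OF M(2)[OF that] norm_ge_zero[of g]] by (simp add: mult.commute)
      finally have "t * (g \<bullet> x) \<le> t * (M * norm g)"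
        using \<open>t > 0\<close> by (simp add: mult_left_mono)
      also have "\<dots> = b" using M(1) assms(3) by (simp add: t_def)
      finally show ?thesis
        using vb(2) that hull_inc[of x S] by (fastforce simp: inner_diff_left)
    qed
    moreover have "(v - t *\<^sub>R g) \<bullet> g < 0"
      using \<open>v \<bullet> g \<le> 0\<close> \<open>t > 0\<close> assms(3) by (simp add: inner_diff_left le_less_trans)
    ultimately show ?thesis using assms(2) by blast
  next
    case False
    then show ?thesis using that by (auto simp: R_def)
  qed
qed

text \<open>For unit vectors \<open>x\<close>, the condition \<open>dist f (e + x) \<le> 1\<close>
  is a half-space condition in \<open>x\<close>, hence passes to the convex hull. Since the hull
  lies in the unit ball, \<open>r \<le> 1\<close>, and scaling \<open>r *\<^sub>R g\<close> up to
  \<open>g\<close> preserves the inequality.\<close>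

lemma unit_hull_in_ball:
  fixes S :: "'a::euclidean_space set"
  assumes "\<And>x. x \<in> S \<Longrightarrow> norm x = 1" "\<And>x. x \<in> S \<Longrightarrow> dist f (e + x) \<le> 1"
    and "r *\<^sub>R g \<in> convex hull S" "r \<ge> 0" "norm g = 1"
  shows "dist f (e + g) \<le> 1"
proof -
  define h where "h = f - e"
  have dist_iff: "dist f (e + x) \<le> 1 \<longleftrightarrow> h \<bullet> h / 2 \<le> h \<bullet> x" if "norm x = 1" for x
  proof -
    have "x \<bullet> x = 1" using that by (simp add: norm_eq_1)
    moreover have "(dist f (e + x))\<^sup>2 = h \<bullet> h - 2 * (h \<bullet> x) + x \<bullet> x"
      unfolding dist_norm power2_norm_eq_inner h_def
      by (simp add: inner_simps algebra_simps inner_commute)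
    moreover have "dist f (e + x) \<le> 1 \<longleftrightarrow> (dist f (e + x))\<^sup>2 \<le> 1"
      by (simp add: power2_le_iff_abs_le abs_square_le_1)
    ultimately show ?thesis by auto
  qed
  have "convex hull S \<subseteq> {x. h \<bullet> x \<ge> h \<bullet> h / 2}"
    by (rule hull_minimal) (use assms(1,2) dist_iff convex_halfspace_ge in blast)+
  then have le: "h \<bullet> h / 2 \<le> r * (h \<bullet> g)"
    using assms(3) by auto
  have "convex hull S \<subseteq> cball 0 1"
    by (rule hull_minimal) (use assms(1) in auto)
  then have "r \<le> 1"
    using assms(3-5) by auto
  have "h \<bullet> h / 2 \<le> h \<bullet> g"
  proof (cases "r = 0")
    case True
    then have "h \<bullet> h = 0" using le inner_ge_zero[of h] by simp
    then show ?thesis by simp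
  next
    case False
    have "0 \<le> r * (h \<bullet> g)" using le inner_ge_zero[of h] by linarith
    then have "0 \<le> h \<bullet> g" using False assms(4) by (simp add: zero_le_mult_iff)
    then have "r * (h \<bullet> g) \<le> h \<bullet> g" using \<open>r \<le> 1\<close> by (simp add: mult_left_le_one_le assms(4))
    with le show ?thesis by simp
  qed
  then show ?thesis using dist_iff assms(5) by blast
qed

text \<open>The criterion by which points on the unit sphere about \<open>e\<close> are recognised
  as spindle points. The set \<open>S\<close> may leave out an endpoint that is not on this
  sphere.\<close>

lemma unit_hull_in_spindle:
  fixes S :: "'a::euclidean_space set"
  assumes "S \<subseteq> {p - e, q - e}" "\<And>x. x \<in> S \<Longrightarrow> norm x = 1"
    and "r *\<^sub>R g \<in> convex hull S" "r \<ge> 0" "norm g = 1"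
  shows "e + g \<in> spindle p q"
  unfolding spindle_eq mem_Collect_eq
proof (intro allI impI)
  fix f assume "dist f p \<le> 1" "dist f q \<le> 1"
  then show "dist f (e + g) \<le> 1"
    using assms by (intro unit_hull_in_ball[of S f e r g]) auto
qed

text \<open>First-order optimality for a unit ball centre e. With r = 0 the conclusion says that e is the
  circumcentre of A.\<close>

lemma active_points_hull:
  fixes A :: "'a::euclidean_space set"
  assumes "finite A" "\<And>x. x \<in> A \<Longrightarrow> dist e x \<le> 1" "g \<noteq> 0"
    and opt: "\<And>v. v \<bullet> g < 0 \<Longrightarrow> \<not> (\<forall>\<^sub>F s in at_right 0. \<forall>x\<in>A. dist (e + s *\<^sub>R v) x \<le> 1)"
  obtains r where "r \<ge> 0" "r *\<^sub>R g \<in> convex hull ((\<lambda>x. x - e) ` {x \<in> A. dist e x = 1})"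
proof (rule convex_hull_ray_alternative)
  show "finite ((\<lambda>x. x - e) ` {x \<in> A. dist e x = 1})" using assms(1) by simp
  show "g \<noteq> 0" by fact
  fix v assume v: "\<And>x. x \<in> (\<lambda>x. x - e) ` {x \<in> A. dist e x = 1} \<Longrightarrow> v \<bullet> x > 0" "v \<bullet> g < 0"
  have "\<forall>\<^sub>F s in at_right 0. \<forall>x\<in>A. dist (e + s *\<^sub>R v) x \<le> 1"
    using assms(1,2) v(1) by (intro eventually_ball_finite ballI eventually_dist_le) auto
  then show False using opt v(2) by blast
qed (use that in blast)

section \<open>Spindle triangles as joins\<close>

text \<open>Among the centres admissible for \<open>a\<close>, \<open>b\<close>, \<open>c\<close>,
  the centre \<open>e\<close> is farthest from \<open>z\<close>, so optimality puts a multiple of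
  \<open>z - e\<close> into the hull of the active vertices. Splitting off \<open>a\<close> leaves a
  vector \<open>y\<close> from the hull of the others; normalised, it gives the point of the
  opposite spindle.\<close>

lemma spindle_join_boundary:
  fixes a b c z e :: "'a::euclidean_space"
  assumes e: "dist e a \<le> 1" "dist e b \<le> 1" "dist e c \<le> 1" "dist e z = 1"
    and z: "\<And>f. dist f a \<le> 1 \<Longrightarrow> dist f b \<le> 1 \<Longrightarrow> dist f c \<le> 1 \<Longrightarrow> dist f z \<le> 1"
  obtains w where "w \<in> spindle b c" "z \<in> spindle a w"
proof -
  define g where "g = z - e"
  have g: "norm g = 1" "z = e + g"
    using e(4) by (simp_all add: g_def dist_norm norm_minus_commute)
  obtain r where r: "r \<ge> 0"
    "r *\<^sub>R g \<in> convex hull ((\<lambda>x. x - e) ` {x \<in> {a, b, c}. dist e x = 1})"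
  proof (rule active_points_hull[of "{a, b, c}" e g])
    show "\<not> (\<forall>\<^sub>F s in at_right 0. \<forall>x\<in>{a, b, c}. dist (e + s *\<^sub>R v) x \<le> 1)" if v: "v \<bullet> g < 0" for v
    proof
      assume "\<forall>\<^sub>F s in at_right 0. \<forall>x\<in>{a, b, c}. dist (e + s *\<^sub>R v) x \<le> 1"
      moreover have "\<forall>\<^sub>F s in at_right (0::real). s > 0"
        by (simp add: eventually_at_right_less)
      ultimately have "\<forall>\<^sub>F s in at_right (0::real). False"
      proof eventually_elim
        case (elim s)
        then have "dist (e + s *\<^sub>R v) z \<le> 1" using z by auto
        moreover have "dist e z < dist (e + s *\<^sub>R v) z"
          using v elim by (intro dist_increasing) (auto simp: g_def)
        ultimately show False using e(4) by simp
      qed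
      then show False by simp
    qed
  qed (use e g in auto)
  define S where "S = (\<lambda>x. x - e) ` {x \<in> {b, c}. dist e x = 1}"
  have S: "S \<subseteq> {b - e, c - e}" "\<And>x. x \<in> S \<Longrightarrow> norm x = 1"
    by (auto simp: S_def dist_norm norm_minus_commute)
  show ?thesis
  proof (cases "dist e a = 1")
    case False
    then have "(\<lambda>x. x - e) ` {x \<in> {a, b, c}. dist e x = 1} = S" by (auto simp: S_def)
    then have "z \<in> spindle b c"
      using unit_hull_in_spindle[OF S _ r(1) g(1)] r(2) g(2) by simp
    then show ?thesis using that right_in_spindle by blast
  next
    case True
    then have "(\<lambda>x. x - e) ` {x \<in> {a, b, c}. dist e x = 1} = insert (a - e) S"
      by (auto simp: S_def)
    with r(2) have hull: "r *\<^sub>R g \<in> convex hull (insert (a - e) S)"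
      by (simp only:)
    have na: "norm (a - e) = 1" using True by (simp add: dist_norm norm_minus_commute)
    show ?thesis
    proof (cases "S = {}")
      case True
      then have "z \<in> spindle a b"
        using unit_hull_in_spindle[of "{a - e}" a e b r g] hull r(1) g na by simp
      then show ?thesis using that right_in_spindle[of b c] spindle_commute by blast
    next
      case False
      then obtain u v y where uv: "u \<ge> 0" "v \<ge> 0" "u + v = 1" "y \<in> convex hull S"
        "r *\<^sub>R g = u *\<^sub>R (a - e) + v *\<^sub>R y"
        using hull by (auto simp: convex_hull_insert)
      show ?thesis
      proof (cases "y = 0")
        \<comment> \<open>The hull of \<open>S\<close> contains 0, so the criterion applies with
          \<open>r = 0\<close> to every unit vector \<open>g\<close>.\<close>
        case True
        then have "z \<in> spindle b c"
          using unit_hull_in_spindle[OF S, of 0 g] uv g by simp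
        then show ?thesis using that right_in_spindle by blast
      next
        case False
        define w where "w = y /\<^sub>R norm y"
        have w: "norm w = 1" "y = norm y *\<^sub>R w" using False by (simp_all add: w_def)
        have "e + w \<in> spindle b c"
          using unit_hull_in_spindle[OF S, of "norm y" w] uv(4) w by simp
        moreover have "z \<in> spindle a (e + w)"
        proof -
          \<comment> \<open>Replacing \<open>y\<close> by its unit vector \<open>w\<close> changes
            the weights to \<open>u\<close> and \<open>v * norm y\<close>; dividing by their sum
            \<open>t\<close> makes them convex again.\<close>
          define t where "t = u + v * norm y"
          have t: "t > 0"
          proof (cases "u = 0")
            case True
            then show ?thesis using uv(3) False by (simp add: t_def)
          next
            case False
            then show ?thesis using uv(1,2) by (simp add: t_def add_pos_nonneg)
          qed
          have "(r / t) *\<^sub>R g = (u / t) *\<^sub>R (a - e) + (v * norm y / t) *\<^sub>R w"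
          proof -
            have "(r / t) *\<^sub>R g = (1 / t) *\<^sub>R (r *\<^sub>R g)" by simp
            also have "\<dots> = (u / t) *\<^sub>R (a - e) + (v / t) *\<^sub>R (norm y *\<^sub>R w)"
              unfolding uv(5) w(2)[symmetric] by (simp add: scaleR_add_right)
            finally show ?thesis by simp
          qed
          moreover have "u / t + v * norm y / t = 1"
            using t by (simp add: t_def flip: add_divide_distrib)
          ultimately have "(r / t) *\<^sub>R g \<in> convex hull {a - e, w}"
            unfolding convex_hull_2 mem_Collect_eq using t uv(1,2)
            by (intro exI[of _ "u / t"] exI[of _ "v * norm y / t"]) simp
          then show ?thesis
            using unit_hull_in_spindle[of "{a - e, w}" a e "e + w" "r / t" g] t r(1) g w na by auto
        qed
        ultimately show ?thesis using that by blast
      qed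
    qed
  qed
qed

text \<open>Let \<open>e\<close> be the common centre for \<open>b\<close> and \<open>c\<close>
  nearest to \<open>a\<close>, at distance \<open>d > 1\<close>. Optimality shows that the point one
  unit beyond \<open>e\<close>, seen from \<open>a\<close>, is in the spindle of \<open>b\<close>
  and \<open>c\<close>; it is at distance \<open>d + 1\<close>. This covers the triangles without a
  common centre.\<close>

lemma far_point_in_spindle:
  fixes a b c :: "'a::euclidean_space"
  assumes no: "\<not> (\<exists>e. dist e a \<le> 1 \<and> dist e b \<le> 1 \<and> dist e c \<le> 1)"
  obtains w where "w \<in> spindle b c" "dist a w > 2"
proof -
  define Q where "Q = cball b 1 \<inter> cball c 1"
  show ?thesis
  proof (cases "Q = {}")
    case True
    then have "\<not> (dist e b \<le> 1 \<and> dist e c \<le> 1)" for e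
      unfolding Q_def by (metis IntI dist_commute empty_iff mem_cball)
    then have "spindle b c = UNIV" by (auto simp: spindle_eq)
    obtain i :: 'a where i: "i \<in> Basis" using nonempty_Basis by blast
    then have "dist a (a + 3 *\<^sub>R i) > 2" by (simp add: dist_norm)
    then show ?thesis using that \<open>spindle b c = UNIV\<close> by blast
  next
    case False
    moreover have "closed Q" by (simp add: Q_def closed_Int)
    ultimately obtain e where e: "e \<in> Q" "\<And>f. f \<in> Q \<Longrightarrow> dist a e \<le> dist a f"
      using distance_attains_inf[of Q a] by blast
    have far: "dist a e > 1" using no e(1) by (auto simp: Q_def dist_commute not_le)
    define d where "d = norm (e - a)"
    have d: "d > 1" using far by (simp add: d_def dist_norm norm_minus_commute)
    define g where "g = (1 / d) *\<^sub>R (e - a)"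
    have g: "norm g = 1" using d unfolding g_def by (auto simp: d_def)
    obtain r where r: "r \<ge> 0"
      "r *\<^sub>R g \<in> convex hull ((\<lambda>x. x - e) ` {x \<in> {b, c}. dist e x = 1})"
    proof (rule active_points_hull[of "{b, c}" e g])
      show "\<not> (\<forall>\<^sub>F s in at_right 0. \<forall>x\<in>{b, c}. dist (e + s *\<^sub>R v) x \<le> 1)" if v: "v \<bullet> g < 0" for v
      proof
        assume "\<forall>\<^sub>F s in at_right 0. \<forall>x\<in>{b, c}. dist (e + s *\<^sub>R v) x \<le> 1"
        moreover have "v \<bullet> (e - a) < 0"
          using v d by (simp add: g_def divide_less_0_iff)
        then have "\<forall>\<^sub>F s in at_right 0. dist (e + s *\<^sub>R v) a < dist e a"
          by (intro eventually_dist_decreasing) (simp add: inner_diff_right)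
        ultimately have "\<forall>\<^sub>F s in at_right (0::real). False"
        proof eventually_elim
          case (elim s)
          then have "e + s *\<^sub>R v \<in> Q" by (simp add: Q_def dist_commute)
          then show False using e(2) elim by (fastforce simp: dist_commute)
        qed
        then show False by simp
      qed
    qed (use e(1) g in \<open>auto simp: Q_def dist_commute\<close>)
    have "e + g \<in> spindle b c"
      by (rule unit_hull_in_spindle[OF _ _ r(2,1) g]) (auto simp: dist_norm norm_minus_commute)
    moreover have "e - a = d *\<^sub>R g" using d by (simp add: g_def)
    then have "(e + g) - a = (d + 1) *\<^sub>R g"
      by (simp add: algebra_simps)
    then have "dist a (e + g) = d + 1"
      using g d by (simp add: dist_norm norm_minus_commute[of a])
    ultimately show ?thesis using that d by simp
  qed
qed

lemma convex_spindle: "convex (spindle p q)"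
proof -
  have "spindle p q = (\<Inter>e\<in>{e. dist e p \<le> 1 \<and> dist e q \<le> 1}. cball e 1)"
    by (auto simp: spindle_eq)
  then show ?thesis by (simp add: convex_INT)
qed

text \<open>The point z is pushed away from a until some admissible unit sphere passes through it.\<close>

lemma spindle_join:
  fixes a b c z :: "'a::euclidean_space"
  assumes z: "\<And>f. dist f a \<le> 1 \<Longrightarrow> dist f b \<le> 1 \<Longrightarrow> dist f c \<le> 1 \<Longrightarrow> dist f z \<le> 1"
  obtains w where "w \<in> spindle b c" "z \<in> spindle a w"
proof -
  define Q where "Q = cball a 1 \<inter> cball b 1 \<inter> cball c 1"
  show ?thesis
  proof (cases "Q = {}")
    \<comment> \<open>No unit ball contains all three vertices: some \<open>w\<close> is more than 2
      away from \<open>a\<close>, so that \<open>spindle a w\<close> is the whole space.\<close>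
    case True
    then obtain w where w: "w \<in> spindle b c" "dist a w > 2"
      using far_point_in_spindle[of a b c] unfolding Q_def by (metis IntI dist_commute empty_iff mem_cball)
    then have "z \<in> spindle a w" by (simp add: spindle_def)
    with w show ?thesis using that by blast
  next
    case ne: False
    show ?thesis
    proof (cases "z = a")
      case True
      then show ?thesis
        using that right_in_spindle spindle_commute by metis
    next
      case False
      \<comment> \<open>The parameters for which the point on the ray from \<open>a\<close> through
        \<open>z\<close> lies in all admissible balls. As these contain \<open>a\<close> as well,
        \<open>J\<close> is bounded.\<close>
      define J where "J = {0..} \<inter> (\<Inter>f\<in>Q. {s. dist f (a + s *\<^sub>R (z - a)) \<le> 1})"
      have "closed J"
        unfolding J_def by (intro closed_Int closed_INT ballI closed_Collect_le continuous_intros)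
      moreover have "J \<subseteq> {0..2 / norm (z - a)}"
      proof
        fix s assume s: "s \<in> J"
        obtain f where f: "f \<in> Q" using ne by blast
        have "dist f (a + s *\<^sub>R (z - a)) \<le> 1" "dist f a \<le> 1" "s \<ge> 0"
          using s f by (auto simp: J_def Q_def dist_commute)
        then have "dist a (a + s *\<^sub>R (z - a)) \<le> 2"
          using dist_triangle3[of a "a + s *\<^sub>R (z - a)" f] by simp
        then have "s * norm (z - a) \<le> 2"
          using \<open>s \<ge> 0\<close> by (simp add: dist_norm)
        then show "s \<in> {0..2 / norm (z - a)}"
          using False \<open>s \<ge> 0\<close> by (simp add: field_simps)
      qed
      ultimately have "compact J"
        using compact_Icc bounded_subset compact_eq_bounded_closed by metis
      moreover have "1 \<in> J"
        using z by (auto simp: J_def Q_def dist_commute)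
      ultimately obtain s where s: "s \<in> J" "\<And>t. t \<in> J \<Longrightarrow> t \<le> s"
        using compact_attains_sup[of J] by blast
      have "s \<ge> 1" using s(2) \<open>1 \<in> J\<close> by blast
      define y where "y = a + s *\<^sub>R (z - a)"
      have y: "dist f y \<le> 1" if "f \<in> Q" for f
        using s(1) that by (simp add: J_def y_def)
      have "compact Q" by (simp add: Q_def compact_Int)
      then obtain e where e: "e \<in> Q" "\<And>f. f \<in> Q \<Longrightarrow> dist f y \<le> dist e y"
        using continuous_attains_sup[OF _ ne, of "\<lambda>f. dist f y"] continuous_on_dist[OF continuous_on_id continuous_on_const]
        by blast
      have "dist e y = 1"
      proof (rule ccontr)
        assume "dist e y \<noteq> 1"
        then have less: "dist e y < 1" using y[OF e(1)] by simp
        \<comment> \<open>The slack at the farthest centre \<open>e\<close> bounds the slack at all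
          others from below, so the ray could be prolonged by \<open>d\<close>, against the
          maximality of \<open>s\<close>.\<close>
        define d where "d = (1 - dist e y) / norm (z - a)"
        have d: "d > 0" using less False by (simp add: d_def)
        have "dist f (a + (s + d) *\<^sub>R (z - a)) \<le> 1" if "f \<in> Q" for f
        proof -
          have "dist y (a + (s + d) *\<^sub>R (z - a)) = norm (d *\<^sub>R (z - a))"
            unfolding dist_norm norm_minus_commute[of y] by (simp add: y_def algebra_simps)
          also have "\<dots> = 1 - dist e y"
            using False less by (simp add: d_def)
          finally show ?thesis
            using e(2)[OF that] dist_triangle[of f "a + (s + d) *\<^sub>R (z - a)" y] by simp
        qed
        then have "s + d \<in> J" using \<open>s \<ge> 1\<close> d by (simp add: J_def)
        then show False using s(2) d by fastforce
      qed
      then obtain w where w: "w \<in> spindle b c" "y \<in> spindle a w"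
        using spindle_join_boundary[of e a b c y] e(1) y by (auto simp: Q_def dist_commute)
      \<comment> \<open>Back from the pushed point \<open>y\<close> to \<open>z\<close>, which lies
        between \<open>a\<close> and \<open>y\<close>.\<close>
      have "z = (1 - 1 / s) *\<^sub>R a + (1 / s) *\<^sub>R y"
        using \<open>s \<ge> 1\<close> by (simp add: y_def algebra_simps)
      moreover have "a \<in> spindle a w"
        using right_in_spindle spindle_commute by metis
      ultimately have "z \<in> spindle a w"
        using convexD_alt[OF convex_spindle _ w(2), of a "1 / s"] \<open>s \<ge> 1\<close> by simp
      then show ?thesis using that w(1) by blast
    qed
  qed
qed

section \<open>Convexity and interior of the spindle kernel\<close>

text \<open>A point \<open>z\<close> of \<open>spindle x q\<close> is in the spindle triangle of
  \<open>p1\<close>, \<open>p2\<close>, \<open>q\<close>. The join reaches it in two steps, first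
  from \<open>p2\<close> to a point \<open>w\<close> of \<open>spindle p2 q\<close>, then from
  \<open>p1\<close>, and each step stays in \<open>X\<close>.\<close>

lemma spindle_kernel_spindle_convex:
  assumes p: "p1 \<in> spindle_kernel X" "p2 \<in> spindle_kernel X"
    and x: "x \<in> spindle p1 p2"
  shows "x \<in> spindle_kernel X"
proof -
  have "z \<in> X" if q: "q \<in> X" and z: "z \<in> spindle x q" for q z
  proof -
    obtain w where "w \<in> spindle p2 q" "z \<in> spindle p1 w"
      using spindle_join[of p1 p2 q z] x z unfolding spindle_eq by blast
    then show ?thesis using p q unfolding spindle_kernel_iff by blast
  qed
  moreover have "x \<in> X"
    using p x unfolding spindle_kernel_iff by blast
  ultimately show ?thesis by (auto simp: spindle_kernel_iff)
qed

text \<open>Suppose that a unit ball containing \<open>p\<close> and \<open>q\<close> had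
  \<open>z\<close> on its boundary. Moving its centre slightly in the direction \<open>q - z\<close>
  keeps \<open>q\<close> and the inner point \<open>m\<close> in the ball but loses
  \<open>z\<close>.\<close>

lemma spindle_subset_strict_spindle_extended:
  fixes m p q z :: "'a::euclidean_space"
  assumes m: "m \<in> open_segment p q" and z: "z \<in> spindle m q" "z \<noteq> q"
  shows "z \<in> strict_spindle p q"
  unfolding strict_spindle_def mem_Collect_eq
proof (intro allI impI)
  fix e assume e: "dist e p \<le> 1" "dist e q \<le> 1"
  have "dist e m < 1"
    using dist_decreases_open_segment[OF m, of e] e by linarith
  then have "dist e z \<le> 1" using z(1) e by (simp add: spindle_eq)
  show "dist e z < 1"
  proof (rule ccontr)
    assume "\<not> dist e z < 1"
    with \<open>dist e z \<le> 1\<close> have ez: "dist e z = 1" by simp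
    define v where "v = q - z"
    have qz: "(q - e) \<bullet> (z - e) < 1" "(z - e) \<bullet> (z - e) = 1" "(q - e) \<bullet> (q - e) \<le> 1"
    proof -
      show zz: "(z - e) \<bullet> (z - e) = 1"
        using ez by (simp add: dist_norm norm_minus_commute flip: power2_norm_eq_inner)
      show qq: "(q - e) \<bullet> (q - e) \<le> 1"
        using e(2) by (simp add: dist_norm norm_minus_commute abs_square_le_1 flip: power2_norm_eq_inner)
      have "0 < ((q - e) - (z - e)) \<bullet> ((q - e) - (z - e))"
        using z(2) by simp
      then have "0 < (q - e) \<bullet> (q - e) - 2 * ((q - e) \<bullet> (z - e)) + (z - e) \<bullet> (z - e)"
        by (simp add: inner_simps algebra_simps inner_commute)
      then show "(q - e) \<bullet> (z - e) < 1" using zz qq by linarith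
    qed
    have v: "v = (q - e) - (z - e)" by (simp add: v_def)
    \<comment> \<open>If \<open>q\<close> is on the sphere too, then \<open>q - e\<close> and
      \<open>z - e\<close> are distinct unit vectors with inner product below 1, so the motion
      brings the centre closer to \<open>q\<close>.\<close>
    have vz: "v \<bullet> (z - e) < 0" and vq: "v \<bullet> (q - e) = (q - e) \<bullet> (q - e) - (q - e) \<bullet> (z - e)"
      unfolding v using qz by (metis diff_less_0_iff_less inner_diff_left) (metis inner_commute inner_diff_left)
    have "\<forall>\<^sub>F s in at_right 0. dist (e + s *\<^sub>R v) q \<le> 1"
    proof (rule eventually_dist_le)
      assume "dist e q = 1"
      then have "(q - e) \<bullet> (q - e) = 1"
        by (simp add: dist_norm norm_minus_commute flip: power2_norm_eq_inner)
      then show "v \<bullet> (q - e) > 0" using vq qz(1) by simp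
    qed fact
    moreover have "\<forall>\<^sub>F s in at_right 0. dist (e + s *\<^sub>R v) m \<le> 1"
      by (rule eventually_dist_le) (use \<open>dist e m < 1\<close> in auto)
    moreover have "\<forall>\<^sub>F s in at_right (0::real). s > 0"
      by (simp add: eventually_at_right_less)
    ultimately have "\<forall>\<^sub>F s in at_right (0::real). False"
    proof eventually_elim
      case (elim s)
      then have "dist (e + s *\<^sub>R v) z \<le> 1" using z(1) by (simp add: spindle_eq)
      then show False using dist_increasing[OF vz] elim ez by fastforce
    qed
    then show False by simp
  qed
qed

text \<open>Prolonging the segment from \<open>q\<close> beyond \<open>m\<close> within the interior
  of the kernel gives \<open>p\<close> whose strict spindle with \<open>q\<close> is an open subset
  of \<open>X\<close> containing \<open>z\<close>.\<close>

lemma spindle_from_kernel_interior: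
  fixes X :: "'a::euclidean_space set"
  assumes m: "m \<in> interior (spindle_kernel X)" and q: "q \<in> X"
  shows "spindle m q \<subseteq> insert q (interior X)"
proof
  fix z assume z: "z \<in> spindle m q"
  show "z \<in> insert q (interior X)"
  proof (cases "z = q")
    case False
    then have "m \<noteq> q" using z spindle_self by blast
    then obtain p where p: "p \<in> interior (spindle_kernel X)" "m \<in> open_segment p q"
      using extend_segment_in_open[of "interior (spindle_kernel X)" m q] m by auto
    have "z \<in> strict_spindle p q"
      using spindle_subset_strict_spindle_extended[OF p(2) z False] .
    moreover have "strict_spindle p q \<subseteq> X"
      using p(1) q interior_subset strict_spindle_subset by (fastforce simp: spindle_kernel_iff)
    ultimately show ?thesis
      using interior_maximal open_strict_spindle_section by blast
  qed simp
qed

lemma midpoint_in_interior_spindle_kernel: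
  assumes "p1 \<in> spindle_kernel X" "p2 \<in> spindle_kernel X" "p1 \<noteq> p2"
  shows "midpoint p1 p2 \<in> interior (spindle_kernel X)"
proof -
  have "strict_spindle p1 p2 \<subseteq> spindle_kernel X"
    using assms spindle_kernel_spindle_convex strict_spindle_subset by blast
  then have "strict_spindle p1 p2 \<subseteq> interior (spindle_kernel X)"
    by (simp add: interior_maximal open_strict_spindle_section)
  moreover have "midpoint p1 p2 \<in> strict_spindle p1 p2"
    using assms(3) by (intro open_segment_strict_spindle) simp
  ultimately show ?thesis by blast
qed

section \<open>Reduction to countable subfamilies\<close>

text \<open>Countably many of the open complements of these closures already cover their union. The
  union of the corresponding subfamilies is countable, and its closure is the least
  possible.\<close>

lemma countable_subfamily_minimal_closure:
  fixes F :: "'a::second_countable_topology set set"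
  obtains G0 where "countable G0" "G0 \<subseteq> F"
    "\<And>G. countable G \<Longrightarrow> G0 \<subseteq> G \<Longrightarrow> G \<subseteq> F \<Longrightarrow> closure (\<Inter>G) = closure (\<Inter>G0)"
proof -
  define \<C> where "\<C> = {G. countable G \<and> G \<subseteq> F}"
  obtain \<U> where \<U>: "\<U> \<subseteq> (\<lambda>G. - closure (\<Inter>G)) ` \<C>" "countable \<U>"
    "\<Union>\<U> = \<Union>((\<lambda>G. - closure (\<Inter>G)) ` \<C>)"
    by (rule Lindelof[of "(\<lambda>G. - closure (\<Inter>G)) ` \<C>"]) auto
  then obtain \<D> where \<D>: "\<D> \<subseteq> \<C>" "countable \<D>" "\<U> = (\<lambda>G. - closure (\<Inter>G)) ` \<D>"
    using countable_subset_image[of \<U>] by metis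
  show ?thesis
  proof (rule that[of "\<Union>\<D>"])
    show "countable (\<Union>\<D>)" "\<Union>\<D> \<subseteq> F"
      using \<D>(1,2) by (auto simp: \<C>_def intro: countable_UN[of _ id, simplified])
    fix G assume G: "countable G" "\<Union>\<D> \<subseteq> G" "G \<subseteq> F"
    have "closure (\<Inter>(\<Union>\<D>)) \<subseteq> closure (\<Inter>H)" if "H \<in> \<D>" for H
      by (rule closure_mono) (use that in blast)
    then have "closure (\<Inter>(\<Union>\<D>)) \<subseteq> - \<Union>\<U>"
      unfolding \<D>(3) by blast
    also have "\<dots> \<subseteq> closure (\<Inter>G)"
      unfolding \<U>(3) using G by (auto simp: \<C>_def)
    finally show "closure (\<Inter>G) = closure (\<Inter>(\<Union>\<D>))"
      using closure_mono[OF Inter_anti_mono[OF G(2)]] by blast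
  qed
qed

theorem theorem6:
  fixes K :: "'a::euclidean_space set" and F :: "'a set set"
  assumes "\<forall>A\<in>F. spindle_starshaped A"
    and "\<forall>G. countable G \<and> G \<subseteq> F \<longrightarrow>
           spindle_starshaped (\<Inter>G) \<and> (\<exists>t. (\<lambda>k. t + k) ` K \<subseteq> spindle_kernel (\<Inter>G))"
  shows "\<exists>t. (\<lambda>k. t + k) ` K \<subseteq> spindle_kernel (\<Inter>F)"
proof -
  obtain G0 where G0: "countable G0" "G0 \<subseteq> F"
    "\<And>G. countable G \<Longrightarrow> G0 \<subseteq> G \<Longrightarrow> G \<subseteq> F \<Longrightarrow> closure (\<Inter>G) = closure (\<Inter>G0)"
    using countable_subfamily_minimal_closure[of F] by blast
  define X where "X = closure (\<Inter>G0)"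
  \<comment> \<open>Each member of \<open>F\<close> is adjoined to \<open>G0\<close> separately: the
    family stays countable, and the closure remains \<open>X\<close>.\<close>
  define B where "B A = \<Inter>(insert A G0)" for A
  have B_closure: "closure (B A) = X" if "A \<in> F" for A
    unfolding B_def X_def using G0 that by (intro G0(3)) auto
  have B_hyp: "spindle_starshaped (B A) \<and> (\<exists>t. (\<lambda>k. t + k) ` K \<subseteq> spindle_kernel (B A))"
    if "A \<in> F" for A
    unfolding B_def using assms(2) G0(1,2) that by (meson countable_insert insert_subset)
  have B_sup: "\<Inter>F \<subseteq> B A" if "A \<in> F" for A
    using G0(2) that by (auto simp: B_def)
  have kernel_B: "spindle_kernel (B A) \<subseteq> spindle_kernel X" if "A \<in> F" for A
    using spindle_kernel_closure B_closure[OF that] by blast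
  have interior_X: "interior X \<subseteq> \<Inter>F"
  proof (rule Inter_greatest)
    fix A assume A: "A \<in> F"
    then obtain p where "p \<in> spindle_kernel (B A)"
      using B_hyp unfolding spindle_starshaped_def by blast
    then have "interior X \<subseteq> B A"
      using interior_closure_subset_of_kernel B_closure[OF A] by blast
    then show "interior X \<subseteq> A" by (auto simp: B_def)
  qed
  have F_sub_X: "\<Inter>F \<subseteq> X"
    unfolding X_def by (rule subset_trans[OF Inter_anti_mono[OF G0(2)] closure_subset])
  obtain t where t: "(\<lambda>k. t + k) ` K \<subseteq> spindle_kernel (\<Inter>G0)"
    using assms(2) G0(1,2) by meson
  then have tX: "(\<lambda>k. t + k) ` K \<subseteq> spindle_kernel X"
    using spindle_kernel_closure unfolding X_def by blast
  show ?thesis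
  proof (cases "\<exists>t'. t' \<noteq> t \<and> (\<lambda>k. t' + k) ` K \<subseteq> spindle_kernel X")
    case True
    then obtain t' where t': "t' \<noteq> t" "(\<lambda>k. t' + k) ` K \<subseteq> spindle_kernel X" by blast
    have "midpoint t t' + k \<in> spindle_kernel (\<Inter>F)" if k: "k \<in> K" for k
    proof -
      have "midpoint t t' + k = midpoint (t + k) (t' + k)"
        by (simp add: midpoint_def algebra_simps flip: scaleR_add_left)
      moreover have "t + k \<in> spindle_kernel X" "t' + k \<in> spindle_kernel X" "t + k \<noteq> t' + k"
        using tX t' k by auto
      ultimately have m: "midpoint t t' + k \<in> interior (spindle_kernel X)"
        using midpoint_in_interior_spindle_kernel by metis
      have "spindle_kernel X \<subseteq> X" by (auto simp: spindle_kernel_iff)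
      then have "midpoint t t' + k \<in> \<Inter>F"
        using m interior_mono interior_X by blast
      moreover have "spindle (midpoint t t' + k) q \<subseteq> \<Inter>F" if "q \<in> \<Inter>F" for q
        using spindle_from_kernel_interior[OF m, of q] that F_sub_X interior_X by blast
      ultimately show ?thesis by (simp only: spindle_kernel_iff) blast
    qed
    then show ?thesis by blast
  next
    case False
    have "t + k \<in> spindle_kernel (B A)" if k: "k \<in> K" and A: "A \<in> F" for k A
    proof -
      obtain t' where t': "(\<lambda>k. t' + k) ` K \<subseteq> spindle_kernel (B A)"
        using B_hyp[OF A] by blast
      \<comment> \<open>The translation supplied for \<open>B A\<close> could depend on
        \<open>A\<close>; uniqueness in the kernel of \<open>X\<close> makes it the same for all
        \<open>A\<close>.\<close>
      then have "t' = t" using False kernel_B[OF A] by blast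
      with t' k show ?thesis by blast
    qed
    moreover have "B A \<subseteq> A" for A by (auto simp: B_def)
    \<comment> \<open>A point \<open>q\<close> of the intersection is in every \<open>B A\<close>,
      so the spindle from \<open>t + k\<close> to \<open>q\<close> stays in \<open>B A\<close> and
      thus in \<open>A\<close>.\<close>
    ultimately have "t + k \<in> spindle_kernel (\<Inter>F)" if "k \<in> K" for k
      using that B_sup unfolding spindle_kernel_iff by blast
    then show ?thesis by blast
  qed
qed

end
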